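(* Let $p,q,r$ be fixed positive integers with $p\geq q\geq r$ and $\gcd(p,q,r)=1$, let $\mathcal{L}$ denote the equation $px+qy=rz$, and let $t:=\gcd(p,q)$. Then, as $n\to\infty$, $$f_{\max}(n,\mathcal{L})\leq 2^{\frac{Crn}{q}+o(n)},\qquad\text{where } C:=1-\frac{t}{p+q}\Big(\frac{p^2+(p-t)(q-t)}{p^2}\Big).$$
   Context: $[n]=\{1,\dots,n\}$. A set $A\subseteq[n]$ is $\mathcal{L}$-free if there are no $x,y,z\in A$ (not necessarily distinct) with $px+qy=rz$ (all solutions are non-trivial here since $p+q-r\neq0$). A maximal $\mathcal{L}$-free subset of $[n]$ is an $\mathcal{L}$-free subset of $[n]$ not properly contained in another $\mathcal{L}$-free subset of $[n]$. $f_{\max}(n,\mathcal{L})$ denotes the number of maximal $\mathcal{L}$-free subsets of $[n]$. *)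

theory Defs
  imports Complex_Main "HOL-Library.Landau_Symbols"
begin

text \<open>Freeness for the equation \<open>p x + q y = r z\<close>, where \<open>x\<close>, \<open>y\<close>, \<open>z\<close> need not be distinct.
  No solution is discarded as trivial: in the intended setting \<open>p + q - r\<close> is nonzero.\<close>

definition solution_free :: "nat \<Rightarrow> nat \<Rightarrow> nat \<Rightarrow> nat set \<Rightarrow> bool" where
  "solution_free p q r A \<longleftrightarrow> \<not> (\<exists>x\<in>A. \<exists>y\<in>A. \<exists>z\<in>A. p * x + q * y = r * z)"

definition maximal_solution_free :: "nat \<Rightarrow> nat \<Rightarrow> nat \<Rightarrow> nat \<Rightarrow> nat set \<Rightarrow> bool" where
  "maximal_solution_free p q r n A \<longleftrightarrow>
     A \<subseteq> {1..n} \<and> solution_free p q r A \<and>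
     \<not> (\<exists>B. B \<subseteq> {1..n} \<and> solution_free p q r B \<and> A \<subset> B)"

definition f_max :: "nat \<Rightarrow> nat \<Rightarrow> nat \<Rightarrow> nat \<Rightarrow> nat" where
  "f_max p q r n = card {A. maximal_solution_free p q r n A}"

end

(*
  Write p = t a and q = t b with a, b coprime; then in every solution z = t w and a x + b y = r w.
  Let m be the largest index such that a maximal solution-free A contains many t w with w in the
  short window (m - d, m]. The multiples of t in A above t m are sparse, so together with a cluster
  of boundedly many t w in the window they form one of only 2^(o(n)) fingerprints. An element above
  r m / b cannot be the x or y of a solution with z <= t m, and in a solution with larger z one of
  x, y is at most r n / (p + q). Hence the fingerprint and A below L = max (r m / b) (r n / (p + q))
  determine A.

  The part of A below r m / b is independent in the graph joining x to y whenever a x + b y = r w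
  for some w in the cluster. All cluster elements are congruent modulo a b^2, so one can choose a
  set P of (1 - C) r m / b vertices (up to a constant), each with as many neighbours as the cluster
  has elements, all outside P: P1 consists of the solvable x below r m / (a + b), and P2 of the
  solvable x between r m / (a + b) and r m / a whose partners are not in P1 and which are
  themselves not partners of an element of P1. A container-type argument then shows that there are
  essentially at most 2^(C r m / b) independent sets.
*)

theory Submission
  imports Defs "HOL-Library.FuncSet"
begin

section \<open>Sparse subsets and independent sets\<close>

lemma sum_power_card_Pow:
  fixes z :: real
  assumes "finite V"
  shows "(\<Sum>T\<in>Pow V. z ^ card T) = (1 + z) ^ card V"
proof -
  have "(\<Prod>v\<in>V. z + 1) = (\<Sum>T\<in>Pow V. (\<Prod>v\<in>T. z) * (\<Prod>v\<in>V - T. 1))"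
    using assms by (rule prod_add)
  then show ?thesis by (simp add: add.commute)
qed

text \<open>Give each subset \<open>T\<close> the weight \<open>z ^ card T\<close> with a small
  \<open>z\<close>: a sparse subset weighs at least \<open>z powr (card V / s)\<close>, while all
  weights together are \<open>(1 + z) ^ card V\<close>, at most
  \<open>exp (z * card V)\<close>.\<close>

lemma card_small_subsets_le:
  fixes \<eta> :: real
  assumes "\<eta> > 0"
  shows "\<exists>s0>0. \<forall>s\<ge>s0. \<forall>V :: 'a set. finite V \<longrightarrow>
           real (card {T. T \<subseteq> V \<and> s * card T \<le> card V}) \<le> 2 powr (\<eta> * card V)"
proof -
  \<comment> \<open>The exponent \<open>\<eta> * ln 2\<close> is split in two: \<open>z\<close>
    takes one half, and \<open>s0\<close> is chosen so that \<open>- ln z / s\<close> takes the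
    other.\<close>
  define z where "z = min 1 (\<eta> * ln 2 / 2)"
  have z: "0 < z" "z \<le> 1" "z \<le> \<eta> * ln 2 / 2"
    using assms by (auto simp: z_def)
  define s0 where "s0 = Suc (nat \<lceil>- ln z * 2 / (\<eta> * ln 2)\<rceil>)"
  have "real (card {T. T \<subseteq> V \<and> s * card T \<le> card V}) \<le> 2 powr (\<eta> * card V)"
    if s: "s \<ge> s0" and V: "finite V" for s and V :: "'a set"
  proof -
    let ?F = "{T. T \<subseteq> V \<and> s * card T \<le> card V}"
    have s0: "real s > 0" "- ln z * 2 / (\<eta> * ln 2) \<le> real s"
      using s unfolding s0_def by linarith+
    have lnz: "- ln z / s \<le> \<eta> * ln 2 / 2"
      using s0 assms by (simp add: field_simps)
    have "real (card ?F) * z powr (card V / s) = (\<Sum>T\<in>?F. z powr (card V / s))"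
      by simp
    also have "\<dots> \<le> (\<Sum>T\<in>?F. z ^ card T)"
    proof (rule sum_mono)
      fix T assume "T \<in> ?F"
      then have "real s * real (card T) \<le> real (card V)"
        by (metis (mono_tags, lifting) mem_Collect_eq of_nat_le_iff of_nat_mult)
      then have "real (card T) \<le> card V / s"
        using s0 by (simp add: field_simps)
      then have "z powr (card V / s) \<le> z powr (card T)"
        using z by (intro powr_mono') auto
      then show "z powr (card V / s) \<le> z ^ card T"
        using z by (simp add: powr_realpow)
    qed
    also have "\<dots> \<le> (\<Sum>T\<in>Pow V. z ^ card T)"
      using V z by (intro sum_mono2) auto
    also have "\<dots> = (1 + z) ^ card V" by (rule sum_power_card_Pow[OF V])
    also have "\<dots> \<le> exp z ^ card V"
      using z by (intro power_mono exp_ge_add_one_self) auto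
    also have "\<dots> = exp (z * card V)" by (metis exp_of_nat2_mult)
    finally have "real (card ?F) \<le> exp (z * card V) / z powr (card V / s)"
      using z by (simp add: field_simps)
    also have "\<dots> = exp ((z + - ln z / s) * card V)"
      using z by (simp add: powr_def exp_diff [symmetric] algebra_simps)
    also have "\<dots> \<le> exp ((\<eta> * ln 2) * card V)"
      using z lnz by (intro iffD2[OF exp_le_cancel_iff] mult_right_mono) linarith+
    also have "\<dots> = 2 powr (\<eta> * card V)" by (simp add: powr_def mult_ac)
    finally show ?thesis .
  qed
  then show ?thesis by (intro exI[of _ s0]) (auto simp: s0_def)
qed

text \<open>By degrees and codegrees, any part of \<open>P\<close> has at least as many neighbours
  as elements. So an independent set pays for its elements in \<open>P\<close> with at least as many
  outside, up to an error that vanishes as \<open>k\<close> grows. The degree \<open>k\<close>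
  depends on \<open>\<eta>\<close> alone because it becomes the cluster size.\<close>

lemma card_independent_sets_le:
  fixes \<eta> :: real
  assumes "\<eta> > 0"
  shows "\<exists>k>0. \<forall>(V :: 'a set) P nb. finite V \<longrightarrow> P \<subseteq> V \<longrightarrow>
           (\<forall>x\<in>P. nb x \<subseteq> V - P \<and> card (nb x) = k) \<longrightarrow>
           (\<forall>y\<in>V. card {x\<in>P. y \<in> nb x} \<le> k) \<longrightarrow>
           real (card {S. S \<subseteq> V \<and> (\<forall>x\<in>S \<inter> P. nb x \<inter> S = {})})
             \<le> 2 powr (real (card V) - real (card P) + \<eta> * real (card V))"
proof -
  from assms have "\<eta> / 2 > 0" by simp
  from card_small_subsets_le[OF this, where 'a='a] obtain s0 where s0: "s0 > 0"
    "\<And>s (V :: 'a set). s \<ge> s0 \<Longrightarrow> finite V \<Longrightarrow>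
      real (card {T. T \<subseteq> V \<and> s * card T \<le> card V}) \<le> 2 powr (\<eta> / 2 * card V)"
    by blast
  \<comment> \<open>Half of \<open>\<eta>\<close> pays for the number of fingerprints, the other
    half for two errors of \<open>card V / s\<close> in the size of a container; hence the demand
    \<open>4 / \<eta> \<le> s\<close>.\<close>
  define s where "s = max s0 (Suc (nat \<lceil>4 / \<eta>\<rceil>))"
  have s: "s \<ge> s0" "s > 0" "4 / \<eta> \<le> real s"
    unfolding s_def by linarith+
  have s2: "2 / real s \<le> \<eta> / 2" using s assms by (simp add: field_simps)
  \<comment> \<open>A vertex of \<open>P\<close> outside \<open>U T\<close> keeps at least
    \<open>s\<close> neighbours outside \<open>N T\<close>, enough for \<open>T\<close> to grow. A
    vertex of \<open>U T\<close> sends at least \<open>s * s\<close> edges into \<open>N T\<close>,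
    where at most \<open>s * s + s\<close> arrive at each vertex, so \<open>U T\<close> exceeds
    \<open>N T\<close> by a factor of at most \<open>1 + 1 / s\<close>.\<close>
  let ?k = "s * s + s"
  have "real (card {S. S \<subseteq> V \<and> (\<forall>x\<in>S \<inter> P. nb x \<inter> S = {})})
             \<le> 2 powr (real (card V) - real (card P) + \<eta> * real (card V))"
    if V: "finite V" and P: "P \<subseteq> V"
      and nb: "\<And>x. x \<in> P \<Longrightarrow> nb x \<subseteq> V - P \<and> card (nb x) = ?k"
      and codeg: "\<And>y. y \<in> V \<Longrightarrow> card {x\<in>P. y \<in> nb x} \<le> ?k"
    for V :: "'a set" and P and nb :: "'a \<Rightarrow> 'a set"
  proof -
    \<comment> \<open>An independent \<open>S\<close> contains a small fingerprint \<open>T\<close> of elements of \<open>P\<close>, maximal subject to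
      having at least \<open>s * card T\<close> neighbours. All other elements of \<open>S \<inter> P\<close> send almost all their
      edges into \<open>N T\<close>, so double counting makes them at most about \<open>card (N T)\<close> in number: what
      \<open>S\<close> may gain inside \<open>P\<close> it loses outside.\<close>
    define N where "N T = (\<Union>x\<in>T. nb x)" for T
    define U where "U T = {x\<in>P. s * s \<le> card (nb x \<inter> N T)}" for T
    define Q where "Q T = T \<union> U T \<union> (V - P - N T)" for T
    define F where "F = {T. T \<subseteq> P \<and> s * card T \<le> card (N T)}"
    have finP: "finite P" using P V finite_subset by blast
    have N_sub: "N T \<subseteq> V - P" if "T \<subseteq> P" for T
      using nb that unfolding N_def by blast
    have finN: "finite (N T)" if "T \<subseteq> P" for T
      using N_sub[OF that] V finite_subset by blast
    have finF: "finite F" using finP unfolding F_def by simp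
    have small: "s * card T \<le> card V" if "T \<in> F" for T
    proof -
      have "card (N T) \<le> card V"
        using that N_sub V unfolding F_def by (intro card_mono) auto
      then show ?thesis using that unfolding F_def by auto
    qed
    have finQ: "finite (Q T)" if "T \<in> F" for T
      using that finP V finite_subset[of T P] unfolding Q_def U_def F_def by auto
    have cardQ: "real (card (Q T)) \<le> card V - card P + \<eta> / 2 * card V" if T: "T \<in> F" for T
    proof -
      have TP: "T \<subseteq> P" using T unfolding F_def by auto
      have "s * s * card (U T) = (\<Sum>x\<in>U T. s * s)" by simp
      also have "\<dots> \<le> (\<Sum>x\<in>U T. card (nb x \<inter> N T))"
        by (rule sum_mono) (auto simp: U_def)
      also have "\<dots> \<le> (\<Sum>x\<in>P. card (nb x \<inter> N T))"
        using finP by (intro sum_mono2) (auto simp: U_def)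
      also have "\<dots> = (\<Sum>x\<in>P. card {y\<in>N T. y \<in> nb x})"
        by (intro sum.cong arg_cong[where f=card]) auto
      also have "\<dots> = (\<Sum>y\<in>N T. card {x\<in>P. y \<in> nb x})"
        using sum_multicount_gen[OF finP finN[OF TP], of "\<lambda>x y. y \<in> nb x" "\<lambda>y. card {x\<in>P. y \<in> nb x}"]
        by simp
      also have "\<dots> \<le> (\<Sum>y\<in>N T. ?k)"
        using codeg N_sub[OF TP] by (intro sum_mono) auto
      finally have "s * s * card (U T) \<le> s * ((s + 1) * card (N T))" by (simp add: algebra_simps)
      then have "s * card (U T) \<le> (s + 1) * card (N T)" using s(2) by simp
      then have "real s * real (card (U T)) \<le> (real s + 1) * real (card (N T))"
        by (metis of_nat_1 of_nat_add of_nat_le_iff of_nat_mult)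
      then have "real (card (U T)) \<le> real (card (N T)) + real (card (N T)) / s"
        using s(2) by (simp add: field_simps)
      moreover have "real (card (N T)) / s \<le> real (card V) / s"
        using N_sub[OF TP] V by (intro divide_right_mono) (auto intro!: card_mono)
      moreover have "real (card T) \<le> real (card V) / s"
      proof -
        have "real s * real (card T) \<le> real (card V)"
          using small[OF T] by (metis of_nat_le_iff of_nat_mult)
        then show ?thesis using s(2) by (simp add: field_simps)
      qed
      moreover have "card (Q T) \<le> card T + card (U T) + card (V - P - N T)"
        unfolding Q_def by (meson card_Un_le add_le_mono1 order_trans)
      moreover have "card (V - P - N T) + card (N T) = card (V - P)"
        using card_Diff_subset[OF finN[OF TP] N_sub[OF TP]] card_mono[OF _ N_sub[OF TP]] V by simp
      moreover have "card (V - P) + card P = card V"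
        using card_Diff_subset[OF finP P] card_mono[OF V P] by simp
      ultimately have "real (card (Q T)) \<le> card V - card P + 2 * (real (card V) / s)"
        by linarith
      also have "2 * (real (card V) / s) = 2 / s * card V" by simp
      also have "\<dots> \<le> \<eta> / 2 * card V" using s2 by (intro mult_right_mono) auto
      finally show ?thesis by simp
    qed
    have "S \<in> (\<Union>T\<in>F. Pow (Q T))"
      if S: "S \<subseteq> V" "\<forall>x\<in>S \<inter> P. nb x \<inter> S = {}" for S
    proof -
      define G where "G = {T. T \<subseteq> S \<inter> P \<and> s * card T \<le> card (N T)}"
      have "finite G" using finP unfolding G_def by simp
      moreover have "{} \<in> G" unfolding G_def by simp
      ultimately obtain T where T: "T \<in> G" and max: "\<And>T'. T' \<in> G \<Longrightarrow> T \<subseteq> T' \<Longrightarrow> T' = T"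
        using finite_has_maximal[of G] by (metis empty_iff)
      have TS: "T \<subseteq> S \<inter> P" and TF: "T \<in> F" and TP: "T \<subseteq> P"
        using T unfolding G_def F_def by auto
      have "x \<in> U T" if x: "x \<in> S" "x \<in> P" "x \<notin> T" for x
      proof (rule ccontr)
        assume "x \<notin> U T"
        then have "card (nb x \<inter> N T) < s * s" using x unfolding U_def by auto
        moreover have "card (nb x) = card (nb x \<inter> N T) + card (nb x - N T)"
        proof -
          have "finite (nb x)" using nb[OF x(2)] V finite_subset by blast
          then show ?thesis by (metis card_Diff_subset_Int card_mono finite_Int
                inf_le1 le_add_diff_inverse)
        qed
        ultimately have "s \<le> card (nb x - N T)" using nb[OF x(2)] by linarith
        moreover have "card (N (insert x T)) = card (N T) + card (nb x - N T)"
        proof -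
          have "N (insert x T) = N T \<union> (nb x - N T)" unfolding N_def by auto
          moreover have "finite (nb x - N T)" using nb[OF x(2)] V finite_subset by blast
          ultimately show ?thesis
            using card_Un_disjoint[OF finN[OF TP], of "nb x - N T"] by (metis Diff_disjoint)
        qed
        moreover have "card (insert x T) = card T + 1"
          using x finite_subset[OF TP finP] by simp
        ultimately have "insert x T \<in> G"
          using T x unfolding G_def by (auto simp: algebra_simps)
        from max[OF this] x show False by auto
      qed
      moreover have "S \<inter> N T = {}" using S(2) TS unfolding N_def by blast
      ultimately have "S \<subseteq> Q T" using S(1) unfolding Q_def by blast
      with TF show ?thesis by blast
    qed
    then have "{S. S \<subseteq> V \<and> (\<forall>x\<in>S \<inter> P. nb x \<inter> S = {})} \<subseteq> (\<Union>T\<in>F. Pow (Q T))" by blast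
    then have "card {S. S \<subseteq> V \<and> (\<forall>x\<in>S \<inter> P. nb x \<inter> S = {})} \<le> card (\<Union>T\<in>F. Pow (Q T))"
      using finF finQ by (intro card_mono) auto
    also have "\<dots> \<le> (\<Sum>T\<in>F. card (Pow (Q T)))" by (rule card_UN_le[OF finF])
    finally have "real (card {S. S \<subseteq> V \<and> (\<forall>x\<in>S \<inter> P. nb x \<inter> S = {})})
        \<le> (\<Sum>T\<in>F. real (card (Pow (Q T))))" unfolding of_nat_sum[symmetric] by (rule iffD2[OF of_nat_le_iff])
    also have "\<dots> \<le> (\<Sum>T\<in>F. 2 powr (card V - card P + \<eta> / 2 * card V))"
    proof (rule sum_mono)
      fix T assume T: "T \<in> F"
      have "real (card (Pow (Q T))) = 2 powr card (Q T)"
        by (simp add: card_Pow[OF finQ[OF T]] powr_realpow)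
      also have "\<dots> \<le> 2 powr (card V - card P + \<eta> / 2 * card V)"
        using cardQ[OF T] by simp
      finally show "real (card (Pow (Q T))) \<le> 2 powr (card V - card P + \<eta> / 2 * card V)" .
    qed
    also have "\<dots> = real (card F) * 2 powr (card V - card P + \<eta> / 2 * card V)" by simp
    also have "\<dots> \<le> 2 powr (\<eta> / 2 * card V) * 2 powr (card V - card P + \<eta> / 2 * card V)"
    proof (rule mult_right_mono)
      have "card F \<le> card {T. T \<subseteq> V \<and> s * card T \<le> card V}"
        using small V P unfolding F_def by (intro card_mono) auto
      with s0(2)[OF s(1) V] show "real (card F) \<le> 2 powr (\<eta> / 2 * card V)" by linarith
    qed auto
    also have "\<dots> = 2 powr (real (card V) - real (card P) + \<eta> * real (card V))"
      using card_mono[OF V P] by (simp add: powr_add[symmetric] algebra_simps)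
    finally show ?thesis .
  qed
  then show ?thesis using s(2) by (intro exI[of _ ?k]) auto
qed

section \<open>Residue classes and the graph of a cluster\<close>

text \<open>With \<open>i\<close> an inverse of \<open>\<alpha>\<close> modulo \<open>h\<close>, the
  condition becomes \<open>h dvd x - i * \<beta>\<close>, so the count is a difference of two
  floors.\<close>

lemma card_arith_progression:
  fixes h \<alpha> \<beta> :: int and u v :: nat
  assumes h: "h > 0" and cop: "coprime \<alpha> h" and uv: "u \<le> v"
  shows "\<bar>real (card {x\<in>{u<..v}. h dvd \<alpha> * int x - \<beta>}) - (real v - real u) / of_int h\<bar> \<le> 1"
proof -
  obtain i j where ij: "i * \<alpha> + j * h = 1"
    using bezout_int[of \<alpha> h] cop by (auto simp: coprime_iff_gcd_eq_1)
  define c where "c = i * \<beta>"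
  have solve: "h dvd \<alpha> * x - \<beta> \<longleftrightarrow> h dvd x - c" for x
  proof
    assume "h dvd \<alpha> * x - \<beta>"
    then have "h dvd i * (\<alpha> * x - \<beta>) + h * (j * x)" by (intro dvd_add) auto
    also have "i * (\<alpha> * x - \<beta>) + h * (j * x) = (i * \<alpha> + j * h) * x - c"
      by (simp add: c_def algebra_simps)
    finally show "h dvd x - c" using ij by simp
  next
    assume "h dvd x - c"
    then have "h dvd \<alpha> * (x - c) - h * (j * \<beta>)" by (intro dvd_diff) auto
    also have "\<alpha> * (x - c) - h * (j * \<beta>) = \<alpha> * x - (i * \<alpha> + j * h) * \<beta>"
      by (simp add: c_def algebra_simps)
    finally show "h dvd \<alpha> * x - \<beta>" using ij by simp
  qed
  \<comment> \<open>\<open>U\<close> and \<open>V\<close> are the largest indices \<open>k\<close>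
    with \<open>c + h * k\<close> at most \<open>u\<close> and at most \<open>v\<close>; the
    interval open on the left makes the count exactly \<open>V - U\<close>.\<close>
  define U where "U = (int u - c) div h"
  define V where "V = (int v - c) div h"
  have U: "U \<le> (real u - of_int c) / of_int h" "(real u - of_int c) / of_int h < U + 1"
    and V: "V \<le> (real v - of_int c) / of_int h" "(real v - of_int c) / of_int h < V + 1"
    using h floor_divide_of_int_eq[of "int u - c" h, where 'a=real] floor_divide_of_int_eq[of "int v - c" h, where 'a=real]
      floor_correct[of "(real u - of_int c) / of_int h"] floor_correct[of "(real v - of_int c) / of_int h"]
    unfolding U_def V_def by auto
  have UV: "U \<le> V" unfolding U_def V_def using uv h by (intro zdiv_mono1) auto
  have "bij_betw (\<lambda>k. nat (c + h * k)) {U<..V} {x\<in>{u<..v}. h dvd \<alpha> * int x - \<beta>}"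
  proof (rule bij_betwI[where g = "\<lambda>x. (int x - c) div h"])
    have range: "int u < c + h * k \<and> c + h * k \<le> int v" if "k \<in> {U<..V}" for k
    proof -
      have "U + 1 \<le> k" "k \<le> V" using that by auto
      then have "h * (U + 1) \<le> h * k" "h * k \<le> h * V" using h by (auto intro: mult_left_mono)
      moreover have "h * V \<le> int v - c" unfolding V_def
        using pos_mod_sign[OF h, of "int v - c"] mult_div_mod_eq[of h "int v - c"] by linarith
      moreover have "int u - c < h * U + h"
        using pos_mod_bound[OF h, of "int u - c"] mult_div_mod_eq[of h "int u - c"]
        unfolding U_def by linarith
      moreover have "h * (U + 1) = h * U + h" by (simp add: algebra_simps)
      ultimately show ?thesis by linarith
    qed
    show "(\<lambda>k. nat (c + h * k)) \<in> {U<..V} \<rightarrow> {x\<in>{u<..v}. h dvd \<alpha> * int x - \<beta>}"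
      using range by (force simp: solve)
    show "(int (nat (c + h * k)) - c) div h = k" if "k \<in> {U<..V}" for k
      using range[OF that] h by simp
    show "(\<lambda>x. (int x - c) div h) \<in> {x\<in>{u<..v}. h dvd \<alpha> * int x - \<beta>} \<rightarrow> {U<..V}"
    proof
      fix x assume "x \<in> {x\<in>{u<..v}. h dvd \<alpha> * int x - \<beta>}"
      then obtain k where k: "int x - c = h * k" and x: "u < x" "x \<le> v" by (auto simp: solve)
      have "h * U < h * k"
        using x k pos_mod_sign[OF h, of "int u - c"] mult_div_mod_eq[of h "int u - c"]
        unfolding U_def by linarith
      then have "U < k" using h by simp
      moreover have "(int x - c) div h \<le> V" unfolding V_def using x h by (intro zdiv_mono1) auto
      ultimately show "(int x - c) div h \<in> {U<..V}" using k h by simp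
    qed
    show "nat (c + h * ((int x - c) div h)) = x" if "x \<in> {x\<in>{u<..v}. h dvd \<alpha> * int x - \<beta>}" for x
      using that by (simp add: solve)
  qed
  from bij_betw_same_card[OF this]
  have "card {x\<in>{u<..v}. h dvd \<alpha> * int x - \<beta>} = nat (V - U)" by simp
  then have "real (card {x\<in>{u<..v}. h dvd \<alpha> * int x - \<beta>}) = V - U" using UV by simp
  moreover have "(real v - real u) / of_int h
      = (real v - of_int c) / of_int h - (real u - of_int c) / of_int h"
    by (simp add: diff_divide_distrib)
  ultimately show ?thesis using U V by linarith
qed

text \<open>Chinese remaindering by a linear combination: \<open>h\<close> times the first
  expression plus \<open>g\<close> times the second is divisible by \<open>g * h\<close> exactly if
  both conditions hold, and its leading coefficient is coprime to \<open>g * h\<close>.\<close>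

lemma card_arith_progression_two:
  fixes g h \<alpha> \<beta> \<gamma> \<delta> :: int and u v :: nat
  assumes gh: "g > 0" "h > 0" "coprime g h" and cop: "coprime \<alpha> g" "coprime \<gamma> h" and uv: "u \<le> v"
  shows "\<bar>real (card {x\<in>{u<..v}. g dvd \<alpha> * int x - \<beta> \<and> h dvd \<gamma> * int x - \<delta>})
           - (real v - real u) / of_int (g * h)\<bar> \<le> 1"
proof -
  have "g dvd \<alpha> * x - \<beta> \<and> h dvd \<gamma> * x - \<delta>
      \<longleftrightarrow> g * h dvd (h * \<alpha> + g * \<gamma>) * x - (h * \<beta> + g * \<delta>)" (is "?l \<longleftrightarrow> g * h dvd ?e") for x
  proof -
    have e1: "?e = h * (\<alpha> * x - \<beta>) + g * (\<gamma> * x - \<delta>)" by (simp add: algebra_simps)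
    have "g * h dvd ?e \<longleftrightarrow> g dvd ?e \<and> h dvd ?e"
      using gh by (metis divides_mult dvd_mult_left dvd_mult_right)
    also have "g dvd ?e \<longleftrightarrow> g dvd \<alpha> * x - \<beta>"
      unfolding e1 using gh by (simp add: dvd_add_left_iff coprime_dvd_mult_right_iff)
    also have "h dvd ?e \<longleftrightarrow> h dvd \<gamma> * x - \<delta>"
      unfolding e1 using gh by (simp add: dvd_add_right_iff coprime_dvd_mult_right_iff coprime_commute)
    finally show ?thesis by simp
  qed
  moreover have "coprime (h * \<alpha> + g * \<gamma>) (g * h)"
  proof -
    have "gcd g (\<gamma> * g + h * \<alpha>) = 1"
      unfolding gcd_add_mult using gh cop by (simp add: coprime_commute)
    moreover have "gcd h (\<alpha> * h + g * \<gamma>) = 1"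
      unfolding gcd_add_mult using gh cop by (simp add: coprime_commute)
    ultimately have "coprime (h * \<alpha> + g * \<gamma>) g" "coprime (h * \<alpha> + g * \<gamma>) h"
      by (simp_all add: coprime_iff_gcd_eq_1 gcd.commute mult.commute add.commute)
    then show ?thesis by simp
  qed
  ultimately show ?thesis
    using card_arith_progression[of "g * h" "h * \<alpha> + g * \<gamma>" u v "h * \<beta> + g * \<delta>"] gh uv
    by simp
qed

text \<open>The conditions in \<open>P\<close> refer to \<open>w0\<close> only, because solvability of \<open>a x + b y = r w\<close> and the
  membership of \<open>y\<close> in \<open>P\<close> depend only on \<open>w\<close> modulo \<open>a b\<^sup>2\<close>. The modulus \<open>b\<^sup>2\<close> expresses
  \<open>b dvd a y - r w\<close> through \<open>x\<close>, using \<open>b y = r w - a x\<close>.\<close>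

lemma cluster_neighbourhoods:
  fixes a b r m d w0 :: nat and W :: "nat set" and nb :: "nat \<Rightarrow> nat set"
  assumes pos: "0 < b" "0 < r" and ba: "b \<le> a"
    and W: "W \<subseteq> {m - d<..m}"
    and cong: "\<And>w. w \<in> W \<Longrightarrow> int (a * b\<^sup>2) dvd int w - int w0"
  defines "nb \<equiv> \<lambda>x. {y. \<exists>w\<in>W. a * x + b * y = r * w}"
  defines "c \<equiv> int (r * w0)"
  defines "P \<equiv> {x \<in> {0<..r * (m - d) div (a + b)}. int b dvd int a * int x - c}
    \<union> {x \<in> {r * m div (a + b)<..r * (m - d) div a}. int b dvd int a * int x - c
        \<and> \<not> int a dvd int b * int x - c \<and> \<not> (int b)\<^sup>2 dvd (int a)\<^sup>2 * int x - (int a - int b) * c}"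
  shows "P \<subseteq> {1..r * m div b}"
    and "\<And>x. x \<in> P \<Longrightarrow> nb x \<subseteq> {1..r * m div b} - P"
    and "\<And>x. x \<in> P \<Longrightarrow> card (nb x) = card W"
    and "\<And>y. card {x\<in>P. y \<in> nb x} \<le> card W"
proof -
  have a: "0 < a" using pos ba by simp
  have finW: "finite W" using W finite_subset by blast
  have wm: "m - d < w \<and> w \<le> m" if "w \<in> W" for w using W that by auto
  have rw: "r * (m - d) < r * w" "r * w \<le> r * m" if "w \<in> W" for w
    using wm[OF that] pos by auto
  have cases: "(x \<ge> 1 \<and> (a + b) * x \<le> r * (m - d) \<and> int b dvd int a * int x - c)
      \<or> (r * m < (a + b) * x \<and> a * x \<le> r * (m - d) \<and> int b dvd int a * int x - c
        \<and> \<not> int a dvd int b * int x - c \<and> \<not> (int b)\<^sup>2 dvd (int a)\<^sup>2 * int x - (int a - int b) * c)"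
    if "x \<in> P" for x
    using that a pos unfolding P_def
    by (auto simp: less_eq_div_iff_mult_less_eq div_less_iff_less_mult mult.commute)
  have ax: "a * x \<le> r * (m - d)" and xB: "int b dvd int a * int x - c" and x1: "x \<ge> 1"
    if "x \<in> P" for x
    using cases[OF that] by (auto simp: add_mult_distrib Suc_le_eq intro!: gr0I)
  show "P \<subseteq> {1..r * m div b}"
  proof
    fix x assume x: "x \<in> P"
    have "b * x \<le> a * x" using ba by simp
    also have "\<dots> \<le> r * (m - d)" by (rule ax[OF x])
    also have "\<dots> \<le> r * m" by simp
    finally show "x \<in> {1..r * m div b}" using x1[OF x] pos
      by (simp add: less_eq_div_iff_mult_less_eq mult.commute)
  qed
  show "card {x\<in>P. y \<in> nb x} \<le> card W" for y
  proof -
    have "{x\<in>P. y \<in> nb x} \<subseteq> (\<lambda>w. (r * w - b * y) div a) ` W"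
    proof
      fix x assume "x \<in> {x\<in>P. y \<in> nb x}"
      then obtain w where w: "w \<in> W" "a * x + b * y = r * w" unfolding nb_def by auto
      then have "(r * w - b * y) div a = x" using a by (metis add_diff_cancel_right' nonzero_mult_div_cancel_left neq0_conv)
      then show "x \<in> (\<lambda>w. (r * w - b * y) div a) ` W" using w by force
    qed
    then show ?thesis by (meson card_image_le card_mono finW finite_imageI le_trans)
  qed
  fix x assume x: "x \<in> P"
  \<comment> \<open>Solvability for \<open>w0\<close> transfers to every \<open>w\<close> of the
    cluster, as \<open>r * w\<close> is congruent to \<open>c\<close> modulo
    \<open>b\<close>.\<close>
  have "\<exists>y. a * x + b * y = r * w" if w: "w \<in> W" for w
  proof -
    have le: "a * x \<le> r * w" using ax[OF x] rw[OF w] by linarith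
    have "int b dvd int w - int w0"
      using cong[OF w] by (meson dvd_trans of_nat_dvd_iff dvd_mult dvd_power pos2 power2_eq_square dvd_triv_left)
    then have "int b dvd int r * (int w - int w0) - (int a * int x - c)"
      by (rule dvd_diff[OF dvd_mult xB[OF x]])
    also have "\<dots> = int (r * w - a * x)" using le by (simp add: c_def algebra_simps of_nat_diff)
    finally have "b dvd r * w - a * x" by (simp only: of_nat_dvd_iff)
    then obtain y where "r * w - a * x = b * y" by (elim dvdE)
    then show ?thesis using le by (intro exI[of _ y]) simp
  qed
  then obtain g where g: "\<And>w. w \<in> W \<Longrightarrow> a * x + b * g w = r * w" by metis
  have "y = g w" if "w \<in> W" "a * x + b * y = r * w" for y w
    using g[OF that(1)] that(2) pos(1) by (metis add_left_cancel mult_left_cancel less_numeral_extra(3))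
  then have "nb x = g ` W"
    unfolding nb_def using g by blast
  moreover have "inj_on g W"
    by (rule inj_onI) (metis g pos(2) mult_left_cancel less_numeral_extra(3))
  ultimately show "card (nb x) = card W" by (simp add: card_image)
  show "nb x \<subseteq> {1..r * m div b} - P"
  proof
    fix y assume "y \<in> nb x"
    then obtain w where w: "w \<in> W" and sol: "a * x + b * y = r * w" unfolding nb_def by auto
    have "y > 0" using sol ax[OF x] rw[OF w] by (intro gr0I) auto
    moreover have "b * y \<le> r * m" using sol rw[OF w] by linarith
    moreover have "y \<notin> P"
    proof
      assume y: "y \<in> P"
      have isol: "int a * int x + int b * int y = int r * int w"
        using sol by (metis of_nat_add of_nat_mult)
      \<comment> \<open>The solution makes \<open>b * y\<close> congruent to \<open>c\<close> modulo
        \<open>a\<close>, which the second part of \<open>P\<close> forbids; so \<open>y\<close>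
        lies in the first part.\<close>
      have "int a dvd int w - int w0"
        using cong[OF w] by (meson dvd_trans of_nat_dvd_iff dvd_triv_left)
      then have "int a dvd int r * (int w - int w0) - int a * int x"
        by (rule dvd_diff[OF dvd_mult dvd_triv_left])
      also have "\<dots> = int b * int y - c" using isol by (simp add: c_def algebra_simps)
      finally have y1: "(a + b) * y \<le> r * (m - d)" "int b dvd int a * int y - c"
        using cases[OF y] by auto
      show False
      proof (cases "(a + b) * x \<le> r * (m - d)")
        case True
        \<comment> \<open>With both in the first part, \<open>(a + b) * x\<close> and
          \<open>(a + b) * y\<close> fall short of \<open>r * w\<close>, which gives
          \<open>x < y\<close> and \<open>y < x\<close>.\<close>
        then have "a * x + b * x < a * x + b * y" "a * y + b * y < a * x + b * y"
          using y1(1) sol rw(1)[OF w] unfolding add_mult_distrib by linarith+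
        then show False by simp
      next
        case False
        \<comment> \<open>Eliminating \<open>y\<close> by \<open>b * y = r * w - a * x\<close> turns
          the divisibility by \<open>b\<close> known for \<open>y\<close> into the one modulo the
          square of \<open>b\<close> that is excluded for \<open>x\<close>.\<close>
        then have nD: "\<not> (int b)\<^sup>2 dvd (int a)\<^sup>2 * int x - (int a - int b) * c"
          using cases[OF x] by auto
        have "(int b)\<^sup>2 dvd int w - int w0"
          using cong[OF w] by (metis dvd_mult_right of_nat_mult of_nat_power)
        moreover have "(int b)\<^sup>2 dvd int b * (int a * int y - c)"
          unfolding power2_eq_square by (rule mult_dvd_mono[OF dvd_refl y1(2)])
        ultimately have "(int b)\<^sup>2 dvd int a * int r * (int w - int w0) - int b * (int a * int y - c)"
          by (rule dvd_diff[OF dvd_mult])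
        also have "int a * int r * (int w - int w0) - int b * (int a * int y - c)
            = int a * (int r * int w - int b * int y) - (int a - int b) * c"
          by (simp add: c_def algebra_simps)
        also have "int r * int w - int b * int y = int a * int x" using isol by simp
        finally show False using nD by (simp add: power2_eq_square mult.assoc)
      qed
    qed
    ultimately show "y \<in> {1..r * m div b} - P"
      using pos by (simp add: less_eq_div_iff_mult_less_eq mult.commute)
  qed
qed

text \<open>Densities are added: the first part has density \<open>1 / b\<close> up to
  \<open>r * m / (a + b)\<close>, the second has density \<open>\<phi>\<close> on an interval of
  length about \<open>r * m * b / (a * (a + b))\<close>. Passing from \<open>m\<close> to
  \<open>m - d\<close> costs at most \<open>r * d\<close> in each part, and rounding costs the
  7.\<close>

lemma card_cluster_sources_ge:
  fixes a b r m d :: nat and c :: int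
  assumes cop: "coprime a b" and pos: "0 < b" and ba: "b \<le> a"
  defines "P \<equiv> {x \<in> {0<..r * (m - d) div (a + b)}. int b dvd int a * int x - c}
    \<union> {x \<in> {r * m div (a + b)<..r * (m - d) div a}. int b dvd int a * int x - c
        \<and> \<not> int a dvd int b * int x - c \<and> \<not> (int b)\<^sup>2 dvd (int a)\<^sup>2 * int x - (int a - int b) * c}"
  shows "real (card P) \<ge> (1 + (real a - 1) * (real b - 1) / (real a)\<^sup>2) / (real a + real b)
           * (real r * real m / real b) - (2 * real r * real d + 7)"
proof -
  define R where "R = real r * real m"
  define X where "X = real r * real (m - d)"
  define D where "D = real r * real d"
  have a: "0 < a" using pos ba by simp
  have R0: "R \<ge> 0" and D0: "D \<ge> 0" unfolding R_def D_def by auto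
  \<comment> \<open>This also holds for \<open>d > m\<close>, where the natural number
    \<open>m - d\<close> is 0.\<close>
  have "real m - real d \<le> real (m - d)" by linarith
  then have "real r * (real m - real d) \<le> X" unfolding X_def by (intro mult_left_mono) auto
  then have X: "R - D \<le> X" unfolding R_def D_def by (simp add: algebra_simps)
  have div_ge: "D / k \<le> D" if "k \<ge> 1" for k :: real
    using mult_left_mono[OF that D0] that by (simp add: field_simps)
  have fl: "real (n div k) \<ge> real n / real k - 1" "real (n div k) \<le> real n / real k" for n k :: nat
    using floor_correct[of "real n / real k"] floor_divide_of_nat_eq[of n k, where 'a=real] by auto
  define u where "u = r * (m - d) div (a + b)"
  define u2 where "u2 = r * m div (a + b)"
  define v2 where "v2 = r * (m - d) div a"
  define B where "B x \<longleftrightarrow> int b dvd int a * int x - c" for x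
  define A where "A x \<longleftrightarrow> int a dvd int b * int x - c" for x
  define E where "E x \<longleftrightarrow> (int b)\<^sup>2 dvd (int a)\<^sup>2 * int x - (int a - int b) * c" for x
  define P1 where "P1 = {x\<in>{0<..u}. B x}"
  define P2 where "P2 = {x\<in>{u2<..v2}. B x \<and> \<not> A x \<and> \<not> E x}"
  have copi: "coprime (int a) (int b)" "coprime (int b) (int a)"
    using cop by (auto simp: coprime_commute)
  have uu2: "u \<le> u2" unfolding u_def u2_def by (intro div_le_mono) simp
  have "P = P1 \<union> P2" unfolding P_def P1_def P2_def u_def u2_def v2_def A_def B_def E_def ..
  moreover have "P1 \<inter> P2 = {}" using uu2 unfolding P1_def P2_def by auto
  ultimately have cardP: "real (card P) = real (card P1) + real (card P2)"
    by (simp add: card_Un_disjoint P1_def P2_def)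
  have P1: "real (card P1) \<ge> R / ((real a + real b) * real b) - D - 2"
  proof -
    have "real (card P1) \<ge> real u / real b - 1"
      using card_arith_progression[of "int b" "int a" 0 u c] pos copi
      unfolding P1_def B_def by (simp add: abs_le_iff)
    moreover have "real u / real b \<ge> (X / (real a + real b) - 1) / real b"
      using fl(1)[of "r * (m - d)" "a + b"] unfolding u_def X_def by (intro divide_right_mono) auto
    moreover have "(X / (real a + real b) - 1) / real b \<ge> ((R - D) / (real a + real b) - 1) / real b"
      using X by (intro divide_right_mono diff_right_mono) auto
    moreover have "((R - D) / (real a + real b) - 1) / real b
        = R / ((real a + real b) * real b) - D / ((real a + real b) * real b) - 1 / real b"
      by (simp add: diff_divide_distrib)
    moreover have "D / ((real a + real b) * real b) \<le> D"
      using a pos by (intro div_ge) (metis Suc_leI add_gr_0 nat_0_less_mult_iff of_nat_add of_nat_mult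
          One_nat_def of_nat_le_iff of_nat_1)
    moreover have "1 / real b \<le> 1" using pos by simp
    ultimately show ?thesis by linarith
  qed
  \<comment> \<open>The density of \<open>B\<close> without \<open>A\<close> and \<open>E\<close>:
    the modulus of \<open>A\<close> is coprime to \<open>b\<close>, and \<open>E\<close> selects one
    in \<open>b\<close> of the residues allowed by \<open>B\<close>.\<close>
  define \<phi> where "\<phi> = 1 / real b * (1 - 1 / real a) * (1 - 1 / real b)"
  have \<phi>: "0 \<le> \<phi>" "\<phi> \<le> 1"
  proof -
    have "0 \<le> 1 / real k" "1 / real k \<le> 1" if "0 < k" for k :: nat using that by auto
    from this[OF a] this[OF pos] show "0 \<le> \<phi>" "\<phi> \<le> 1"
      unfolding \<phi>_def by (intro mult_nonneg_nonneg mult_le_one; linarith)+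
  qed
  have "v2 \<ge> X / a - 1" "u2 \<le> R / (a + b)"
    using fl(1)[of "r * (m - d)" a] fl(2)[of "r * m" "a + b"] unfolding v2_def u2_def X_def R_def by auto
  moreover have "X / a \<ge> (R - D) / a" using X by (intro divide_right_mono) auto
  moreover have "D / a \<le> D" using a by (intro div_ge) auto
  ultimately have len: "real v2 - real u2 \<ge> R * (1 / a - 1 / (real a + real b)) - D - 1"
    by (simp add: algebra_simps diff_divide_distrib)
  have P2: "real (card P2) \<ge> \<phi> * (real v2 - real u2) - 4"
  proof (cases "u2 \<le> v2")
    case False
    then have "\<phi> * (real v2 - real u2) \<le> 0" using \<phi> by (intro mult_nonneg_nonpos) auto
    then show ?thesis by simp
  next
    case True
    define I where "I = {u2<..v2}"
    have finI: "finite I" unfolding I_def by simp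
    define l where "l = real v2 - real u2"
    \<comment> \<open>Modulo \<open>b\<close>, the expression in \<open>E\<close> is
      \<open>a * (a * x - c)\<close>. As \<open>E\<close> implies \<open>B\<close>, inclusion and
      exclusion needs only four counts, each off by at most 1, which explains the error 4.\<close>
    have EB: "B x" if "E x" for x
    proof -
      have "int b dvd (int a)\<^sup>2 * int x - (int a - int b) * c - int b * c"
        using that unfolding E_def by (metis dvd_diff dvd_trans dvd_triv_left power2_eq_square)
      also have "\<dots> = int a * (int a * int x - c)" by (simp add: algebra_simps power2_eq_square)
      finally show ?thesis using copi unfolding B_def by (simp add: coprime_dvd_mult_right_iff)
    qed
    have cB: "real (card {x\<in>I. B x}) \<ge> l / b - 1"
      using card_arith_progression[of "int b" "int a" u2 v2 c] pos copi True
      unfolding I_def l_def B_def by (simp add: abs_le_iff)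
    have cBA: "real (card {x\<in>I. B x \<and> A x}) \<le> l / (b * a) + 1"
      using card_arith_progression_two[of "int b" "int a" "int a" "int b" u2 v2 c c] a pos copi True
      unfolding I_def l_def B_def A_def by (simp add: abs_le_iff)
    have cE: "real (card {x\<in>I. E x}) \<le> l / (real b)\<^sup>2 + 1"
      using card_arith_progression[of "(int b)\<^sup>2" "(int a)\<^sup>2" u2 v2 "(int a - int b) * c"] pos copi True
      unfolding I_def l_def E_def by (simp add: abs_le_iff)
    have cEA: "real (card {x\<in>I. E x \<and> A x}) \<ge> l / ((real b)\<^sup>2 * a) - 1"
      using card_arith_progression_two[of "(int b)\<^sup>2" "int a" "(int a)\<^sup>2" "int b" u2 v2
          "(int a - int b) * c" c] a pos copi True
      unfolding I_def l_def E_def A_def by (simp add: abs_le_iff)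
    have un: "card ({x\<in>I. B x \<and> A x} \<union> {x\<in>I. E x}) + card {x\<in>I. E x \<and> A x}
        = card {x\<in>I. B x \<and> A x} + card {x\<in>I. E x}"
    proof -
      have "{x\<in>I. B x \<and> A x} \<inter> {x\<in>I. E x} = {x\<in>I. E x \<and> A x}" using EB by auto
      then show ?thesis using card_Un_Int[of "{x\<in>I. B x \<and> A x}" "{x\<in>I. E x}"] finI by simp
    qed
    have "P2 = {x\<in>I. B x} - ({x\<in>I. B x \<and> A x} \<union> {x\<in>I. E x})"
      unfolding P2_def I_def by auto
    then have "card P2 \<ge> card {x\<in>I. B x} - card ({x\<in>I. B x \<and> A x} \<union> {x\<in>I. E x})"
      using finI by (simp add: diff_card_le_card_Diff)
    then have "real (card P2) \<ge> l / b - l / (b * a) - l / (real b)\<^sup>2 + l / ((real b)\<^sup>2 * a) - 4"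
      using un cB cBA cE cEA by linarith
    also have "l / b - l / (b * a) - l / (real b)\<^sup>2 + l / ((real b)\<^sup>2 * a) = \<phi> * l"
      using a pos unfolding \<phi>_def by (simp add: field_simps power2_eq_square)
    finally show ?thesis unfolding l_def .
  qed
  have "\<phi> * (real v2 - real u2) \<ge> \<phi> * (R * (1 / a - 1 / (real a + real b)) - D - 1)"
    using \<phi> len by (intro mult_left_mono) auto
  moreover have "\<phi> * (D + 1) \<le> 1 * (D + 1)" using \<phi> D0 by (intro mult_right_mono) auto
  ultimately have "\<phi> * (real v2 - real u2) \<ge> \<phi> * (R * (1 / a - 1 / (real a + real b))) - D - 1"
    by (simp add: algebra_simps)
  moreover have "R / ((real a + real b) * real b) + \<phi> * (R * (1 / a - 1 / (real a + real b)))
      = (1 + (real a - 1) * (real b - 1) / (real a)\<^sup>2) / (real a + real b) * (R / b)"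
  proof -
    have "1 / a - 1 / (real a + real b) = real b / (a * (real a + real b))"
      using a pos by (simp add: field_simps)
    moreover have "\<phi> = (real a - 1) * (real b - 1) / (a * (real b)\<^sup>2)"
      using a pos unfolding \<phi>_def by (simp add: field_simps power2_eq_square)
    moreover have "R / (S * B) + (A - 1) * (B - 1) / (A * B\<^sup>2) * (R * (B / (A * S)))
        = (1 + (A - 1) * (B - 1) / A\<^sup>2) / S * (R / B)" if "A > 0" "B > 0" "S > 0" for A B S
    proof -
      have "(A - 1) * (B - 1) / (A * B\<^sup>2) * (R * (B / (A * S)))
          = (A - 1) * (B - 1) / A\<^sup>2 / S * (R / B)"
        using that by (simp add: power2_eq_square mult_ac)
      then show ?thesis by (simp add: add_divide_distrib distrib_right)
    qed
    ultimately show ?thesis using a pos by simp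
  qed
  ultimately show ?thesis using cardP P1 P2 unfolding R_def D_def by (simp add: algebra_simps)
qed

text \<open>The independence bound is applied to \<open>{1..r * m div b}\<close>, with the cluster
  \<open>W\<close> as the source of edges and its size as the degree. Since \<open>k\<close> is
  fixed before \<open>d\<close>, the window length may later be chosen in terms of
  \<open>k\<close>.\<close>

lemma card_cluster_free_sets_le:
  fixes a b r :: nat and \<eta> :: real
  assumes \<eta>: "\<eta> > 0" and cop: "coprime a b" and pos: "0 < b" "0 < r" and ba: "b \<le> a"
  defines "c \<equiv> (1 + (real a - 1) * (real b - 1) / (real a)\<^sup>2) / (real a + real b)"
  shows "\<exists>k>0. \<forall>d m w0 W. W \<subseteq> {m - d<..m} \<longrightarrow> card W = k \<longrightarrow>
           (\<forall>w\<in>W. int (a * b\<^sup>2) dvd int w - int w0) \<longrightarrow>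
           real (card {S. S \<subseteq> {1..r * m div b} \<and> \<not> (\<exists>x\<in>S. \<exists>y\<in>S. \<exists>w\<in>W. a * x + b * y = r * w)})
             \<le> 2 powr ((1 - c + \<eta>) * (real r * real m / real b) + (2 * real r * real d + 7))"
proof -
  obtain k where k: "k > 0" and "\<forall>(V :: nat set) P nb. finite V \<longrightarrow> P \<subseteq> V \<longrightarrow>
       (\<forall>x\<in>P. nb x \<subseteq> V - P \<and> card (nb x) = k) \<longrightarrow>
       (\<forall>y\<in>V. card {x\<in>P. y \<in> nb x} \<le> k) \<longrightarrow>
       real (card {S. S \<subseteq> V \<and> (\<forall>x\<in>S \<inter> P. nb x \<inter> S = {})})
         \<le> 2 powr (real (card V) - real (card P) + \<eta> * real (card V))"
    using card_independent_sets_le[OF \<eta>, where 'a=nat] by (elim exE conjE) (rule that)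
  note indep = this(2)[rule_format]
  have "real (card {S. S \<subseteq> {1..r * m div b} \<and> \<not> (\<exists>x\<in>S. \<exists>y\<in>S. \<exists>w\<in>W. a * x + b * y = r * w)})
          \<le> 2 powr ((1 - c + \<eta>) * (real r * real m / real b) + (2 * real r * real d + 7))"
    (is "real (card ?F) \<le> _")
    if W: "W \<subseteq> {m - d<..m}" "card W = k" and cong: "\<And>w. w \<in> W \<Longrightarrow> int (a * b\<^sup>2) dvd int w - int w0"
    for d m w0 W
  proof -
    define V where "V = {1..r * m div b}"
    define nb where "nb x = {y. \<exists>w\<in>W. a * x + b * y = r * w}" for x
    define P where "P = {x \<in> {0<..r * (m - d) div (a + b)}. int b dvd int a * int x - int (r * w0)}
    \<union> {x \<in> {r * m div (a + b)<..r * (m - d) div a}. int b dvd int a * int x - int (r * w0)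
        \<and> \<not> int a dvd int b * int x - int (r * w0)
        \<and> \<not> (int b)\<^sup>2 dvd (int a)\<^sup>2 * int x - (int a - int b) * int (r * w0)}"
    note nbhd = cluster_neighbourhoods[OF pos ba W(1) cong, folded nb_def P_def V_def]
    have "real (card {S. S \<subseteq> V \<and> (\<forall>x\<in>S \<inter> P. nb x \<inter> S = {})})
         \<le> 2 powr (real (card V) - real (card P) + \<eta> * real (card V))"
      using nbhd W(2) by (intro indep) (auto simp: V_def)
    moreover have "?F \<subseteq> {S. S \<subseteq> V \<and> (\<forall>x\<in>S \<inter> P. nb x \<inter> S = {})}"
      unfolding V_def nb_def by blast
    then have "card ?F \<le> card {S. S \<subseteq> V \<and> (\<forall>x\<in>S \<inter> P. nb x \<inter> S = {})}"
      by (intro card_mono) (auto simp: V_def)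
    ultimately have "real (card ?F) \<le> 2 powr (real (card V) - real (card P) + \<eta> * real (card V))"
      by linarith
    also have "\<dots> \<le> 2 powr ((1 - c + \<eta>) * (real r * real m / real b) + (2 * real r * real d + 7))"
    proof -
      define Q where "Q = real r * real m / real b"
      have V: "real (card V) \<le> Q"
        unfolding V_def Q_def using of_nat_div_le_of_nat[of "r * m" b, where 'a=real] by simp
      moreover have "\<eta> * real (card V) \<le> \<eta> * Q"
        using V \<eta> by (intro mult_left_mono) auto
      moreover have "real (card P) \<ge> c * Q - (2 * real r * real d + 7)"
        using card_cluster_sources_ge[OF cop pos(1) ba] unfolding P_def c_def Q_def by blast
      ultimately show ?thesis unfolding Q_def[symmetric] by (simp add: algebra_simps)
    qed
    finally show ?thesis .
  qed
  then show ?thesis using k by blast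
qed

section \<open>Windows, fingerprints and fibres\<close>

text \<open>\<open>m\<close> is the last element of \<open>X\<close> that closes a window of length
  \<open>d\<close> holding \<open>K\<close> elements. Beyond it, a block of length \<open>d\<close>
  with more than \<open>K\<close> elements would have a last element closing a later such
  window.\<close>

lemma sparse_beyond_dense_window:
  fixes X :: "nat set"
  assumes X: "X \<subseteq> {1..N}" and d: "d > 0" and K: "K > 0"
  obtains m where "m \<le> N" "card (X \<inter> {m<..}) \<le> K * (N div d + 1)"
    "m = 0 \<or> K \<le> card (X \<inter> {m - d<..m})"
proof -
  define M where "M = {m\<in>X. K \<le> card (X \<inter> {m - d<..m})}"
  \<comment> \<open>The value 0 stands for the absence of a dense window; the sparsity bound then
    covers all of \<open>X\<close>.\<close>
  define m where "m = Max (insert 0 M)"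
  have finX: "finite X" using X finite_subset by blast
  then have finM: "finite M" unfolding M_def by simp
  have le_m: "m' \<le> m" if "m' \<in> M" for m'
    using finM that unfolding m_def by (intro Max_ge) auto
  have mM: "m \<in> insert 0 M" unfolding m_def using finM by (intro Max_in) auto
  have window: "card (X \<inter> {m + j * d<..m + (j + 1) * d}) \<le> K" for j
  proof (rule ccontr)
    let ?Y = "X \<inter> {m + j * d<..m + (j + 1) * d}"
    assume "\<not> card ?Y \<le> K"
    then have Y: "K \<le> card ?Y" "?Y \<noteq> {}" by auto
    have finY: "finite ?Y" using finX by simp
    define m' where "m' = Max ?Y"
    have m': "m' \<in> ?Y" unfolding m'_def by (rule Max_in[OF finY Y(2)])
    have "?Y \<subseteq> X \<inter> {m' - d<..m'}"
    proof
      fix x assume x: "x \<in> ?Y"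
      then have "x \<le> m'" unfolding m'_def using finY by (intro Max_ge) auto
      then show "x \<in> X \<inter> {m' - d<..m'}" using x m' d by (auto simp: algebra_simps)
    qed
    then have "card ?Y \<le> card (X \<inter> {m' - d<..m'})" using finX by (intro card_mono) auto
    then have "m' \<in> M" using Y m' unfolding M_def by auto
    from le_m[OF this] m' show False by auto
  qed
  have "X \<inter> {m<..} \<subseteq> (\<Union>j\<in>{..<N div d + 1}. X \<inter> {m + j * d<..m + (j + 1) * d})"
  proof
    fix x assume x: "x \<in> X \<inter> {m<..}"
    define j where "j = (x - m - 1) div d"
    have "j \<le> N div d" unfolding j_def using x X by (intro div_le_mono) auto
    moreover have "j * d \<le> x - m - 1" unfolding j_def by simp
    moreover have "x - m - 1 < j * d + d" unfolding j_def
      using d by (metis add.commute dividend_less_div_times)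
    ultimately show "x \<in> (\<Union>j\<in>{..<N div d + 1}. X \<inter> {m + j * d<..m + (j + 1) * d})"
      using x by (intro UN_I[of j]) (auto simp: algebra_simps)
  qed
  then have "card (X \<inter> {m<..}) \<le> card (\<Union>j\<in>{..<N div d + 1}. X \<inter> {m + j * d<..m + (j + 1) * d})"
    using finX by (intro card_mono) auto
  also have "\<dots> \<le> (\<Sum>j<N div d + 1. card (X \<inter> {m + j * d<..m + (j + 1) * d}))"
    by (rule card_UN_le) simp
  also have "\<dots> \<le> (\<Sum>j<N div d + 1. K)" by (rule sum_mono) (rule window)
  finally have "card (X \<inter> {m<..}) \<le> K * (N div d + 1)" by (simp add: mult.commute)
  moreover have "m \<le> N" "m = 0 \<or> K \<le> card (X \<inter> {m - d<..m})" using mM X unfolding M_def by auto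
  ultimately show ?thesis using that by blast
qed

lemma pigeonhole_residue_class:
  fixes Y :: "nat set"
  assumes "finite Y" and M: "M > 0" and "k * M \<le> card Y"
  obtains w0 Z where "Z \<subseteq> Y" "card Z = k" "\<And>w. w \<in> Z \<Longrightarrow> int M dvd int w - int w0"
proof -
  have "\<exists>w0. k \<le> card {y\<in>Y. y mod M = w0}"
  proof (rule ccontr)
    assume "\<nexists>w0. k \<le> card {y\<in>Y. y mod M = w0}"
    then have less: "card {y\<in>Y. y mod M = w0} < k" for w0 by (simp add: not_le)
    have "Y = (\<Union>w0\<in>{..<M}. {y\<in>Y. y mod M = w0})" using M by auto
    then have "card Y = card (\<Union>w0\<in>{..<M}. {y\<in>Y. y mod M = w0})" by (rule arg_cong)
    also have "\<dots> \<le> (\<Sum>w0<M. card {y\<in>Y. y mod M = w0})" by (rule card_UN_le) simp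
    also have "\<dots> < (\<Sum>w0<M. k)" using less M by (intro sum_strict_mono) auto
    finally show False using assms(3) by (simp add: mult.commute)
  qed
  then obtain w0 where "k \<le> card {y\<in>Y. y mod M = w0}" by blast
  then obtain Z where Z: "Z \<subseteq> {y\<in>Y. y mod M = w0}" "card Z = k"
    by (rule obtain_subset_with_card_n)
  have "int M dvd int w - int w0" if "w \<in> Z" for w
  proof -
    have "int M dvd int w - int w mod int M" by (rule dvd_minus_mod)
    moreover have "int w mod int M = int w0" using Z that by (auto simp flip: of_nat_mod)
    ultimately show ?thesis by simp
  qed
  then show ?thesis using that Z by blast
qed

text \<open>\<open>A \<union> A'\<close> is solution-free, so maximality of \<open>A\<close> absorbs
  \<open>A'\<close>. In each solution two of the three members are undisputed between
  \<open>A\<close> and \<open>A'\<close>; the third lies in one of the two sets, which would then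
  contain the whole solution.\<close>

lemma maximal_solution_free_subset:
  fixes a b p q r t :: nat
  assumes pq: "p = t * a" "q = t * b" and t: "0 < t" "coprime t r" and pos: "0 < b" and ba: "b \<le> a"
    and A: "maximal_solution_free p q r n A" and A': "maximal_solution_free p q r n A'"
    and L: "r * m div b \<le> L" "r * n div (p + q) \<le> L"
    and low: "A \<inter> {1..L} = A' \<inter> {1..L}"
    and high: "\<And>w. w > m \<Longrightarrow> t * w \<in> A \<longleftrightarrow> t * w \<in> A'"
  shows "A' \<subseteq> A"
proof -
  have sub: "A \<subseteq> {1..n}" "A' \<subseteq> {1..n}"
    and free: "solution_free p q r A" "solution_free p q r A'"
    using A A' unfolding maximal_solution_free_def by auto
  have low_iff: "x \<in> A \<longleftrightarrow> x \<in> A'" if "x \<le> L" for x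
  proof (cases "x \<ge> 1")
    case True
    then show ?thesis using low that by (metis IntD1 IntI atLeastAtMost_iff)
  next
    case False
    then show ?thesis using sub by (meson atLeastAtMost_iff subsetD)
  qed
  have "solution_free p q r (A \<union> A')"
    unfolding solution_free_def
  proof (intro notI, elim bexE)
    fix x y z assume x: "x \<in> A \<union> A'" and y: "y \<in> A \<union> A'" and z: "z \<in> A \<union> A'"
      and eq: "p * x + q * y = r * z"
    have "t dvd r * z" unfolding eq[symmetric] pq by (simp add: mult.assoc)
    then have "t dvd z" using t by (simp add: coprime_dvd_mult_right_iff)
    then obtain w where w: "z = t * w" by (elim dvdE)
    have "t * (a * x + b * y) = t * (r * w)" using eq unfolding pq w by (simp add: algebra_simps)
    then have sol: "a * x + b * y = r * w" using t by simp
    have "\<not> (x \<in> A \<and> y \<in> A \<and> z \<in> A)" "\<not> (x \<in> A' \<and> y \<in> A' \<and> z \<in> A')"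
      using free eq unfolding solution_free_def by blast+
    \<comment> \<open>For \<open>w \<le> m\<close> both \<open>x\<close> and \<open>y\<close> are at
      most \<open>L\<close>, because \<open>b \<le> a\<close>. For \<open>w > m\<close> the member
      \<open>z\<close> is settled by \<open>high\<close>, and the smaller of \<open>x\<close> and
      \<open>y\<close> is at most \<open>r * n / (p + q)\<close>.\<close>
    moreover have "(x \<in> A \<longleftrightarrow> x \<in> A') \<and> (y \<in> A \<longleftrightarrow> y \<in> A')
        \<or> (z \<in> A \<longleftrightarrow> z \<in> A') \<and> ((x \<in> A \<longleftrightarrow> x \<in> A') \<or> (y \<in> A \<longleftrightarrow> y \<in> A'))"
    proof (cases "w \<le> m")
      case True
      have "x \<le> L" "y \<le> L"
      proof -
        have "b * x \<le> a * x" using ba by simp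
        moreover have "r * w \<le> r * m" using True by simp
        ultimately have "b * x \<le> r * m" "b * y \<le> r * m" using sol by linarith+
        then have "x \<le> r * m div b" "y \<le> r * m div b"
          using pos by (auto simp: less_eq_div_iff_mult_less_eq mult.commute)
        then show "x \<le> L" "y \<le> L" using L(1) by linarith+
      qed
      then show ?thesis using low_iff by blast
    next
      case False
      then have "z \<in> A \<longleftrightarrow> z \<in> A'" using high w by simp
      moreover have "min x y \<le> L"
      proof -
        have "(p + q) * min x y \<le> p * x + q * y"
          unfolding add_mult_distrib by (intro add_mono mult_le_mono2) auto
        also have "\<dots> \<le> r * n" unfolding eq using z sub by (intro mult_le_mono2) auto
        finally have "min x y \<le> r * n div (p + q)"
          using pos t by (simp add: less_eq_div_iff_mult_less_eq mult.commute pq)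
        then show ?thesis using L(2) by linarith
      qed
      then have "x \<le> L \<or> y \<le> L" by linarith
      ultimately show ?thesis using low_iff by blast
    qed
    ultimately show False using x y z by auto
  qed
  moreover have "A \<union> A' \<subseteq> {1..n}" using sub by simp
  ultimately have "\<not> A \<subset> A \<union> A'"
    using A unfolding maximal_solution_free_def by meson
  then show ?thesis by auto
qed

lemma card_low_parts_le:
  fixes N L :: nat
  assumes "N \<le> L"
  shows "card {S. S \<subseteq> {1..L} \<and> Q (S \<inter> {1..N})} \<le> card {S. S \<subseteq> {1..N} \<and> Q S} * 2 ^ (L - N)"
proof -
  let ?G = "{S. S \<subseteq> {1..N} \<and> Q S}"
  have "{S. S \<subseteq> {1..L} \<and> Q (S \<inter> {1..N})} \<subseteq> (\<lambda>(S, R). S \<union> R) ` (?G \<times> Pow {N<..L})"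
  proof
    fix S assume S: "S \<in> {S. S \<subseteq> {1..L} \<and> Q (S \<inter> {1..N})}"
    then have "S = (S \<inter> {1..N}) \<union> (S \<inter> {N<..L})" by force
    moreover have "S \<inter> {1..N} \<in> ?G" "S \<inter> {N<..L} \<in> Pow {N<..L}" using S by auto
    ultimately show "S \<in> (\<lambda>(S, R). S \<union> R) ` (?G \<times> Pow {N<..L})"
      by (metis (mono_tags, lifting) SigmaI case_prod_conv image_eqI)
  qed
  moreover have "finite (?G \<times> Pow {N<..L})" by auto
  ultimately have "card {S. S \<subseteq> {1..L} \<and> Q (S \<inter> {1..N})} \<le> card (?G \<times> Pow {N<..L})"
    by (meson surj_card_le)
  then show ?thesis by (simp add: card_cartesian_product card_Pow)
qed

text \<open>Once the multiples of \<open>t\<close> beyond \<open>t * m\<close> are fixed, a maximal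
  set is determined by its part in \<open>{1..L}\<close>. Up to \<open>r * m div b\<close> this part
  avoids solutions through the cluster \<open>Z\<close>; the rest of it is counted as
  arbitrary.\<close>

lemma card_fibre_le:
  fixes a b p q r t :: nat
  assumes pq: "p = t * a" "q = t * b" and t: "0 < t" "coprime t r" and pos: "0 < b" and ba: "b \<le> a"
  shows "card {A. maximal_solution_free p q r n A \<and> (\<forall>w\<in>Z. t * w \<in> A) \<and> (\<forall>w>m. t * w \<in> A \<longleftrightarrow> w \<in> T)}
    \<le> card {S. S \<subseteq> {1..r * m div b} \<and> \<not> (\<exists>x\<in>S. \<exists>y\<in>S. \<exists>w\<in>Z. a * x + b * y = r * w)}
       * 2 ^ (max (r * m div b) (r * n div (p + q)) - r * m div b)"
proof -
  let ?F = "{A. maximal_solution_free p q r n A \<and> (\<forall>w\<in>Z. t * w \<in> A) \<and> (\<forall>w>m. t * w \<in> A \<longleftrightarrow> w \<in> T)}"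
  define L where "L = max (r * m div b) (r * n div (p + q))"
  define Q where "Q S \<longleftrightarrow> \<not> (\<exists>x\<in>S. \<exists>y\<in>S. \<exists>w\<in>Z. a * x + b * y = r * w)" for S
  have inj: "inj_on (\<lambda>A. A \<inter> {1..L}) ?F"
  proof (rule inj_onI)
    fix A A' assume A: "A \<in> ?F" and A': "A' \<in> ?F" and eq: "A \<inter> {1..L} = A' \<inter> {1..L}"
    have L: "r * m div b \<le> L" "r * n div (p + q) \<le> L" unfolding L_def by simp_all
    have max: "maximal_solution_free p q r n A" "maximal_solution_free p q r n A'"
      using A A' by simp_all
    have high: "t * w \<in> A \<longleftrightarrow> t * w \<in> A'" if "w > m" for w
      using A A' that by blast
    show "A = A'"
      using maximal_solution_free_subset[OF pq t pos ba max L eq high]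
        maximal_solution_free_subset[OF pq t pos ba max(2,1) L eq[symmetric] high[symmetric]]
      by (intro subset_antisym)
  qed
  have "(\<lambda>A. A \<inter> {1..L}) ` ?F \<subseteq> {S. S \<subseteq> {1..L} \<and> Q (S \<inter> {1..r * m div b})}"
  proof (rule image_subsetI)
    fix A assume A: "A \<in> ?F"
    then have free: "solution_free p q r A" unfolding maximal_solution_free_def by simp
    have "a * x + b * y \<noteq> r * w" if "x \<in> A" "y \<in> A" "w \<in> Z" for x y w
    proof
      assume "a * x + b * y = r * w"
      then have "t * (a * x + b * y) = t * (r * w)" by simp
      then have "p * x + q * y = r * (t * w)" unfolding pq by (simp add: algebra_simps)
      moreover have "t * w \<in> A" using A that by simp
      ultimately show False using free that unfolding solution_free_def by blast
    qed
    then show "A \<inter> {1..L} \<in> {S. S \<subseteq> {1..L} \<and> Q (S \<inter> {1..r * m div b})}"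
      unfolding Q_def by auto
  qed
  then have "card ?F \<le> card {S. S \<subseteq> {1..L} \<and> Q (S \<inter> {1..r * m div b})}"
    by (intro card_inj_on_le[OF inj]) auto
  also have "\<dots> \<le> card {S. S \<subseteq> {1..r * m div b} \<and> Q S} * 2 ^ (L - r * m div b)"
    by (rule card_low_parts_le) (simp add: L_def)
  finally show ?thesis unfolding Q_def L_def .
qed

text \<open>One set \<open>T\<close> stores two pieces of data: up to \<open>m\<close> it is the
  cluster, beyond \<open>m\<close> it lists every \<open>w\<close> with \<open>t * w\<close> in
  \<open>A\<close>, so that \<open>m\<close> suffices to separate them again.\<close>

lemma exists_sparse_fingerprint:
  fixes M K d k n t :: nat and A :: "nat set"
  assumes A: "A \<subseteq> {1..n}" and t: "t > 0" and d: "d > 0" and k: "k > 0" and M: "M > 0"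
  shows "\<exists>m T. t * m \<le> n \<and> T \<subseteq> {1..n} \<and> card T \<le> k + k * M * (n div t div d + 1)
    \<and> (m = 0 \<or> T \<inter> {..m} \<subseteq> {m - d<..m} \<and> card (T \<inter> {..m}) = k
          \<and> (\<exists>w0. \<forall>w\<in>T \<inter> {..m}. int M dvd int w - int w0))
    \<and> (\<forall>w\<in>T \<inter> {..m}. t * w \<in> A) \<and> (\<forall>w>m. t * w \<in> A \<longleftrightarrow> w \<in> T)"
proof -
  define X where "X = {w. t * w \<in> A}"
  have X: "X \<subseteq> {1..n div t}"
    using A t unfolding X_def by (auto simp: less_eq_div_iff_mult_less_eq mult.commute Suc_le_eq intro!: gr0I)
  also have "\<dots> \<subseteq> {1..n}" by (auto intro: order_trans[OF _ div_le_dividend])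
  finally have Xn: "X \<subseteq> {1..n}" .
  have finX: "finite X" using Xn finite_subset by blast
  \<comment> \<open>The window is asked for \<open>k * M\<close> elements so that some residue class
    modulo \<open>M\<close> receives \<open>k\<close> of them.\<close>
  obtain m where m: "m \<le> n div t" "card (X \<inter> {m<..}) \<le> k * M * (n div t div d + 1)"
    "m = 0 \<or> k * M \<le> card (X \<inter> {m - d<..m})"
    using sparse_beyond_dense_window[OF X d, of "k * M"] k M by auto
  have tm: "t * m \<le> n" using m(1) t by (simp add: less_eq_div_iff_mult_less_eq mult.commute)
  show ?thesis
  proof (cases "m = 0")
    case True
    have "X \<inter> {m<..} = X" "X \<inter> {..m} = {}" using X True by auto
    then show ?thesis using True tm Xn m(2)
      by (intro exI[of _ m] exI[of _ X]) (auto simp: X_def)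
  next
    case False
    with m(3) have "k * M \<le> card (X \<inter> {m - d<..m})" by simp
    then obtain w0 Z where Z: "Z \<subseteq> X \<inter> {m - d<..m}" "card Z = k"
      "\<And>w. w \<in> Z \<Longrightarrow> int M dvd int w - int w0"
      using pigeonhole_residue_class[of "X \<inter> {m - d<..m}" M k] finX M by blast
    define T where "T = Z \<union> (X \<inter> {m<..})"
    have TZ: "T \<inter> {..m} = Z" using Z(1) unfolding T_def by auto
    have "card T \<le> k + k * M * (n div t div d + 1)"
      unfolding T_def using card_Un_le[of Z "X \<inter> {m<..}"] Z(2) m(2) by linarith
    moreover have "T \<subseteq> {1..n}" using Z(1) Xn unfolding T_def by blast
    moreover have "t * w \<in> A \<longleftrightarrow> w \<in> T" if "w > m" for w
      using that Z(1) unfolding T_def X_def by auto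
    moreover have "t * w \<in> A" if "w \<in> Z" for w using that Z(1) unfolding X_def by auto
    ultimately show ?thesis
      using Z tm unfolding TZ[symmetric] by (intro exI[of _ m] exI[of _ T]) blast
  qed
qed

section \<open>Union bound and asymptotics\<close>

text \<open>Lets the \<open>n + 1\<close> choices of \<open>m\<close> and the constant terms of the
  exponent disappear in a linear error.\<close>

lemma eventually_log_affine_le:
  fixes K \<eta> :: real
  assumes "\<eta> > 0"
  shows "\<forall>\<^sub>F n :: nat in at_top. log 2 (real n + 1) + K \<le> \<eta> * real n"
proof -
  have "filterlim (\<lambda>n :: nat. real n + 1) at_top at_top"
    using filterlim_tendsto_add_at_top[OF tendsto_const[of 1] filterlim_real_sequentially]
    by (simp add: add.commute)
  then have lim: "((\<lambda>n :: nat. ln (real n + 1) / (real n + 1)) \<longlongrightarrow> 0) at_top"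
    by (rule filterlim_compose[OF ln_x_over_x_tendsto_0])
  have "0 < \<eta> / 2 * ln 2" using assms by simp
  from order_tendstoD(2)[OF lim this]
  have "\<forall>\<^sub>F n :: nat in at_top. ln (real n + 1) / (real n + 1) < \<eta> / 2 * ln 2" .
  moreover have "\<forall>\<^sub>F n :: nat in at_top. real n \<ge> 2 / \<eta> * (K + \<eta> / 2)"
    using filterlim_real_sequentially unfolding filterlim_at_top by blast
  ultimately show ?thesis
  proof eventually_elim
    case (elim n)
    from elim(1) have "ln (real n + 1) \<le> \<eta> / 2 * ln 2 * (real n + 1)"
      by (simp add: pos_divide_less_eq)
    then have "log 2 (real n + 1) \<le> \<eta> / 2 * (real n + 1)"
      unfolding log_def by (simp add: pos_divide_le_eq mult_ac)
    moreover have "K + \<eta> / 2 \<le> \<eta> / 2 * real n"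
      using elim(2) assms by (simp add: field_simps)
    ultimately show ?case by (simp add: field_simps)
  qed
qed

text \<open>A union bound over the fingerprints \<open>(m, T)\<close>. The error
  \<open>\<eta>\<close> is split into thirds: one for the cluster bound, one for the number of
  sparse sets \<open>T\<close>, one for the choice of \<open>m\<close> together with all
  constants.\<close>

lemma eventually_f_max_le:
  fixes a b p q r t :: nat and \<eta> :: real
  assumes pq: "p = t * a" "q = t * b" and t: "0 < t" "coprime t r"
    and cop: "coprime a b" and pos: "0 < b" "0 < r" and ba: "b \<le> a" and \<eta>: "\<eta> > 0"
    and C: "C = 1 - (1 + (real a - 1) * (real b - 1) / (real a)\<^sup>2) / (real a + real b)"
  shows "C \<ge> 0"
    and "\<forall>\<^sub>F n in at_top. real (f_max p q r n) \<le> 2 powr (C * real r * real n / real q + \<eta> * real n)"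
proof -
  define c where "c = (1 + (real a - 1) * (real b - 1) / (real a)\<^sup>2) / (real a + real b)"
  have ab1: "real a \<ge> 1" "real b \<ge> 1" "real b \<le> real a" using pos ba by auto
  have c0: "c \<ge> 0" unfolding c_def using ab1 by simp
  \<comment> \<open>This amounts to \<open>C \<ge> b / (a + b)\<close>, that is,
    \<open>r * n / (p + q) \<le> C * r * n / q\<close>: an arbitrary choice below
    \<open>r * n / (p + q)\<close> is within the bound.\<close>
  have "c \<le> real a / (real a + real b)"
    unfolding c_def
  proof (rule divide_right_mono)
    have "real b - 1 \<le> (real a)\<^sup>2" using ab1 self_le_power[of "real a" 2] by linarith
    then have "(real a - 1) * (real b - 1) \<le> (real a - 1) * (real a)\<^sup>2"
      using ab1 by (intro mult_left_mono) auto
    then have "(real a - 1) * (real b - 1) / (real a)\<^sup>2 \<le> real a - 1"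
      using pos ba by (subst pos_divide_le_eq) auto
    then show "1 + (real a - 1) * (real b - 1) / (real a)\<^sup>2 \<le> real a" by simp
  qed simp
  moreover have "real a / (real a + real b) = 1 - real b / (real a + real b)"
    using ab1 by (simp add: field_simps)
  ultimately have C_ge: "C \<ge> real b / (real a + real b)" and C1: "C \<le> 1"
    using c0 unfolding C c_def[symmetric] by auto
  have "real b / (real a + real b) \<ge> 0" by simp
  with C_ge show C0: "C \<ge> 0" by linarith
  have q: "0 < q" using pq t pos by simp
  \<comment> \<open>Scaled so that \<open>\<eta>1 * (r * n / q)\<close> is
    \<open>\<eta> / 3 * n\<close>.\<close>
  define \<eta>1 where "\<eta>1 = \<eta> * real q / (3 * real r)"
  have \<eta>1: "\<eta>1 > 0" unfolding \<eta>1_def using \<eta> q pos by simp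
  obtain k where k: "k > 0" and "\<forall>d m w0 W. W \<subseteq> {m - d<..m} \<longrightarrow> card W = k \<longrightarrow>
           (\<forall>w\<in>W. int (a * b\<^sup>2) dvd int w - int w0) \<longrightarrow>
           real (card {S. S \<subseteq> {1..r * m div b} \<and> \<not> (\<exists>x\<in>S. \<exists>y\<in>S. \<exists>w\<in>W. a * x + b * y = r * w)})
             \<le> 2 powr ((1 - c + \<eta>1) * (real r * real m / real b) + (2 * real r * real d + 7))"
    using card_cluster_free_sets_le[OF \<eta>1 cop pos ba, folded c_def] by (elim exE conjE) (rule that)
  note cluster = this(2)[rule_format]
  have \<eta>3: "\<eta> / 3 > 0" using \<eta> by simp
  obtain s where s: "s > 0"
    and "\<forall>s'\<ge>s. \<forall>V :: nat set. finite V \<longrightarrow>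
           real (card {T. T \<subseteq> V \<and> s' * card T \<le> card V}) \<le> 2 powr (\<eta> / 3 * card V)"
    using card_small_subsets_le[OF \<eta>3, where 'a=nat] by (elim exE conjE) (rule that)
  note small = this(2)[rule_format, OF order_refl]
  define M where "M = a * b\<^sup>2"
  have M: "M > 0" unfolding M_def using pos ba by simp
  \<comment> \<open>Beyond \<open>m\<close> a fingerprint has at most \<open>k * M\<close> elements
    per block of length \<open>d\<close>. With this \<open>d\<close>, the number of full blocks
    contributes at most \<open>n\<close> to \<open>2 * s * card T\<close>, and for large
    \<open>n\<close> the constant \<open>k + k * M\<close> contributes at most another
    \<open>n\<close>.\<close>
  define d where "d = 2 * s * (k * M)"
  have d: "d > 0" unfolding d_def using s k M by simp
  define D where "D = 2 * real r * real d + 7"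
  have D0: "D \<ge> 0" unfolding D_def by simp
  define ok where "ok m T \<longleftrightarrow> m = 0 \<or> T \<inter> {..m} \<subseteq> {m - d<..m} \<and> card (T \<inter> {..m}) = k
          \<and> (\<exists>w0. \<forall>w\<in>T \<inter> {..m}. int M dvd int w - int w0)" for m and T :: "nat set"
  define F where "F n = (\<lambda>(m, T). {A. maximal_solution_free p q r n A \<and>
      (\<forall>w\<in>T \<inter> {..m}. t * w \<in> A) \<and> (\<forall>w>m. t * w \<in> A \<longleftrightarrow> w \<in> T)})" for n
  define I where "I n = {(m, T). t * m \<le> n \<and> T \<subseteq> {1..n} \<and> s * card T \<le> n \<and> ok m T}" for n
  have fibre: "real (card (F n (m, T)))
      \<le> 2 powr (C * real r * real n / real q + \<eta> / 3 * real n + D + 1)"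
    if mT: "(m, T) \<in> I n" for n m T
  proof -
    define N where "N = r * m div b"
    define N' where "N' = r * n div (p + q)"
    define Q where "Q = real r * real m / real b"
    define R where "R = real r * real n / real q"
    define G where "G = {S. S \<subseteq> {1..r * m div b} \<and>
      \<not> (\<exists>x\<in>S. \<exists>y\<in>S. \<exists>w\<in>T \<inter> {..m}. a * x + b * y = r * w)}"
    have Q0: "Q \<ge> 0" unfolding Q_def by simp
    have G: "real (card G) \<le> 2 powr ((C + \<eta>1) * Q + D)"
    proof (cases "m = 0")
      case True
      \<comment> \<open>Without a cluster the bound still holds, because
        \<open>r * m div b = 0\<close> leaves only the empty set.\<close>
      then have "G \<subseteq> {{}}" unfolding G_def by auto
      then have "card G \<le> card {{} :: nat set}" by (intro card_mono) auto
      then have "real (card G) \<le> 1" by simp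
      also have "1 \<le> 2 powr ((C + \<eta>1) * Q + D)"
        using C0 \<eta>1 Q0 D0 by (intro ge_one_powr_ge_zero) auto
      finally show ?thesis .
    next
      case False
      then obtain w0 where "T \<inter> {..m} \<subseteq> {m - d<..m}" "card (T \<inter> {..m}) = k"
        "\<And>w. w \<in> T \<inter> {..m} \<Longrightarrow> int M dvd int w - int w0"
        using mT unfolding I_def ok_def by auto
      from cluster[OF this(1,2) this(3)[unfolded M_def]]
      show ?thesis unfolding G_def C c_def[symmetric] Q_def D_def by simp
    qed
    have QR: "Q \<le> R"
    proof -
      have "t * m \<le> n" using mT unfolding I_def by simp
      then have "real t * real m \<le> real n" by (metis of_nat_le_iff of_nat_mult)
      then have "real r * (real t * real m) / real q \<le> R"
        unfolding R_def by (intro divide_right_mono mult_left_mono) auto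
      moreover have "real r * (real t * real m) / real q = Q"
        unfolding Q_def pq using t by simp
      ultimately show ?thesis by simp
    qed
    have NQ: "Q \<le> real N + 1"
    proof -
      have "r * m < b * (N + 1)" unfolding N_def using dividend_less_times_div[OF pos(1), of "r * m"] by simp
      then have "real r * real m < real b * (real N + 1)" by (metis of_nat_1 of_nat_add of_nat_less_iff of_nat_mult)
      then show ?thesis unfolding Q_def using pos by (simp add: field_simps)
    qed
    have N'R: "real N' \<le> C * R"
    proof -
      have "real N' \<le> real (r * n) / real (p + q)" unfolding N'_def by (rule of_nat_div_le_of_nat)
      also have "\<dots> = real b / (real a + real b) * R"
        unfolding R_def pq using t pos by (simp flip: distrib_left)
      also have "\<dots> \<le> C * R" using C_ge by (rule mult_right_mono) (simp add: R_def)
      finally show ?thesis .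
    qed
    have "card (F n (m, T)) \<le> card G * 2 ^ (max N N' - N)"
      using card_fibre_le[OF pq t pos(1) ba] unfolding F_def G_def N_def N'_def by simp
    then have "real (card (F n (m, T))) \<le> real (card G * 2 ^ (max N N' - N))"
      by (rule iffD2[OF of_nat_le_iff])
    also have "\<dots> = real (card G) * 2 powr (real (max N N') - real N)"
      by (simp add: powr_realpow[symmetric] of_nat_diff)
    also have "\<dots> \<le> 2 powr ((C + \<eta>1) * Q + D) * 2 powr (real (max N N') - real N)"
      using G by (rule mult_right_mono) simp
    also have "\<dots> = 2 powr ((C + \<eta>1) * Q + D + (real (max N N') - real N))"
      by (simp add: powr_add)
    also have "\<dots> \<le> 2 powr (C * R + \<eta>1 * R + D + 1)"
    proof -
      \<comment> \<open>If \<open>N' \<le> N\<close>, no extra elements arise and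
        \<open>Q \<le> R\<close> is enough. Otherwise \<open>C * N \<le> N\<close> cancels against
        the \<open>- N\<close>, leaving \<open>N' \<le> C * R\<close>; the 1 covers the rounding in
        \<open>Q \<le> N + 1\<close>.\<close>
      have "C * Q + (real (max N N') - real N) \<le> C * R + 1"
      proof (cases "N' \<le> N")
        case True
        then show ?thesis using mult_left_mono[OF QR C0] by simp
      next
        case False
        have "C * Q \<le> C * real N + C" using mult_left_mono[OF NQ C0] by (simp add: algebra_simps)
        moreover have "C * real N \<le> 1 * real N" using C1 by (rule mult_right_mono) simp
        ultimately show ?thesis using False N'R C1 by simp
      qed
      moreover have "\<eta>1 * Q \<le> \<eta>1 * R" using \<eta>1 QR by (intro mult_left_mono) auto
      ultimately show ?thesis by (simp add: algebra_simps)
    qed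
    also have "\<eta>1 * R = \<eta> / 3 * real n" unfolding \<eta>1_def R_def using q pos by simp
    finally show ?thesis unfolding R_def by (simp add: mult.assoc)
  qed
  have le_if_mult_le: "m \<le> n" if "t * m \<le> n" for m n
    using that t(1) mult_le_mono1[of "Suc 0" t m] by linarith
  have finI: "finite (I n)" for n
  proof (rule finite_subset)
    show "I n \<subseteq> {0..n} \<times> Pow {1..n}"
      by (auto simp: I_def dest: le_if_mult_le)
  qed auto
  have cardI: "real (card (I n)) \<le> (real n + 1) * 2 powr (\<eta> / 3 * real n)" for n
  proof -
    have "I n \<subseteq> {0..n} \<times> {T. T \<subseteq> {1..n} \<and> s * card T \<le> card {1..n}}"
      by (auto simp: I_def dest: le_if_mult_le)
    then have "card (I n) \<le> card ({0..n} \<times> {T. T \<subseteq> {1..n} \<and> s * card T \<le> card {1..n}})"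
      by (intro card_mono) auto
    also have "\<dots> = (n + 1) * card {T. T \<subseteq> {1..n} \<and> s * card T \<le> card {1..n}}"
      by (simp add: card_cartesian_product)
    finally have "real (card (I n)) \<le> (real n + 1) * real (card {T. T \<subseteq> {1..n} \<and> s * card T \<le> card {1..n}})"
      by (metis of_nat_1 of_nat_add of_nat_le_iff of_nat_mult)
    also have "\<dots> \<le> (real n + 1) * 2 powr (\<eta> / 3 * real n)"
      using small[of "{1..n}"] by (intro mult_left_mono) auto
    finally show ?thesis .
  qed
  have cover: "{A. maximal_solution_free p q r n A} \<subseteq> (\<Union>i\<in>I n. F n i)"
    if n: "n \<ge> 2 * s * (k + k * M)" for n
  proof
    fix A assume A: "A \<in> {A. maximal_solution_free p q r n A}"
    then have "A \<subseteq> {1..n}" unfolding maximal_solution_free_def by simp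
    from exists_sparse_fingerprint[OF this t(1) d k M, folded ok_def]
    obtain m T where mT: "t * m \<le> n" "T \<subseteq> {1..n}" "card T \<le> k + k * M * (n div t div d + 1)"
      "ok m T" "\<forall>w\<in>T \<inter> {..m}. t * w \<in> A" "\<forall>w>m. t * w \<in> A \<longleftrightarrow> w \<in> T"
      by (elim exE conjE)
    have "2 * (s * card T) \<le> 2 * s * (k + k * M * (n div t div d + 1))"
      using mT(3) by simp
    also have "\<dots> = 2 * s * (k + k * M) + n div t div d * d"
      unfolding d_def by (simp add: algebra_simps)
    also have "\<dots> \<le> n + n"
      using n by (intro add_mono order_trans[OF div_times_less_eq_dividend div_le_dividend])
    finally have "s * card T \<le> n" by simp
    then have "(m, T) \<in> I n" using mT unfolding I_def by simp
    moreover have "A \<in> F n (m, T)" using A mT unfolding F_def by simp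
    ultimately show "A \<in> (\<Union>i\<in>I n. F n i)" by blast
  qed
  from eventually_log_affine_le[OF \<eta>3, of "D + 1"] eventually_ge_at_top[of "2 * s * (k + k * M)"]
  show "\<forall>\<^sub>F n in at_top. real (f_max p q r n) \<le> 2 powr (C * real r * real n / real q + \<eta> * real n)"
  proof eventually_elim
    case (elim n)
    define E where "E = C * real r * real n / real q + \<eta> / 3 * real n + D + 1"
    have finF: "finite (F n i)" for i
      by (rule finite_subset[of _ "Pow {1..n}"])
         (auto simp: F_def maximal_solution_free_def split: prod.splits)
    have "f_max p q r n \<le> card (\<Union>i\<in>I n. F n i)"
      unfolding f_max_def by (rule card_mono[OF finite_UN_I[OF finI finF] cover[OF elim(2)]])
    also have "\<dots> \<le> (\<Sum>i\<in>I n. card (F n i))" by (rule card_UN_le[OF finI])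
    finally have "real (f_max p q r n) \<le> (\<Sum>i\<in>I n. real (card (F n i)))"
      unfolding of_nat_sum[symmetric] by (rule iffD2[OF of_nat_le_iff])
    also have "\<dots> \<le> (\<Sum>i\<in>I n. 2 powr E)"
      using fibre unfolding E_def by (intro sum_mono) auto
    also have "\<dots> = real (card (I n)) * 2 powr E" by simp
    also have "\<dots> \<le> ((real n + 1) * 2 powr (\<eta> / 3 * real n)) * 2 powr E"
      by (rule mult_right_mono[OF cardI]) simp
    also have "\<dots> = 2 powr (log 2 (real n + 1) + \<eta> / 3 * real n + E)"
      by (simp add: powr_add)
    also have "\<dots> \<le> 2 powr (C * real r * real n / real q + \<eta> * real n)"
      using elim(1) unfolding E_def by simp
    finally show ?case .
  qed
qed

theorem theorem1p2:
  fixes p q r t :: nat and C :: real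
  assumes "p \<ge> q" and "q \<ge> r" and "r > 0"
    and "Gcd {p, q, r} = 1"
    and "t = gcd p q"
    and "C = 1 - real t / (real p + real q) *
               (((real p)\<^sup>2 + (real p - real t) * (real q - real t)) / (real p)\<^sup>2)"
  shows "\<exists>\<epsilon> :: nat \<Rightarrow> real. \<epsilon> \<in> o(\<lambda>n. real n) \<and>
           (\<forall>\<^sub>F n in at_top.
              real (f_max p q r n) \<le> 2 powr (C * real r * real n / real q + \<epsilon> n))"
proof -
  have q: "0 < q" and p: "0 < p" using assms(1-3) by auto
  then have t: "0 < t" using assms(5) by simp
  obtain a b where "p = a * t" "q = b * t" and ab_coprime: "coprime a b"
    using gcd_coprime_exists[of p q, folded assms(5)] t by blast
  then have ab: "p = t * a" "q = t * b" by (simp_all only: mult.commute)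
  have pos: "0 < b" "0 < a" using ab p q by (auto intro!: gr0I)
  have ba: "b \<le> a" using assms(1) ab t by simp
  have cop: "coprime t r"
    using assms(4) unfolding assms(5) coprime_iff_gcd_eq_1 by (simp add: gcd.assoc)
  \<comment> \<open>Dividing \<open>p\<close> and \<open>q\<close> by \<open>t\<close> expresses the
    constant through \<open>a\<close> and \<open>b\<close> alone.\<close>
  have C: "C = 1 - (1 + (real a - 1) * (real b - 1) / (real a)\<^sup>2) / (real a + real b)"
  proof -
    define x y z where "x = real a" and "y = real b" and "z = real t"
    have xyz: "x > 0" "y > 0" "z > 0" using pos t unfolding x_def y_def z_def by auto
    have "z / (z * x + z * y) = 1 / (x + y)" using xyz by (simp flip: distrib_left)
    moreover have "((z * x)\<^sup>2 + (z * x - z) * (z * y - z)) / (z * x)\<^sup>2 = 1 + (x - 1) * (y - 1) / x\<^sup>2"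
      using xyz by (simp add: field_simps power2_eq_square)
    ultimately show ?thesis unfolding assms(6) ab x_def y_def z_def by simp
  qed
  note bound = eventually_f_max_le[OF ab t cop ab_coprime pos(1) assms(3) ba _ C]
  have C0: "C \<ge> 0" using bound(1)[of 1] by simp
  define e where "e n = C * real r * real n / real q" for n :: nat
  have e0: "e n \<ge> 0" for n unfolding e_def using C0 by simp
  \<comment> \<open>The excess of the true exponent over \<open>e n\<close>, cut off at 0; the
    eventual bounds for all \<open>\<eta>\<close> make it \<open>o(n)\<close>.\<close>
  define \<epsilon> where "\<epsilon> n = max 0 (log 2 (real (f_max p q r n)) - e n)" for n
  have "\<epsilon> \<in> o(\<lambda>n. real n)"
  proof (rule landau_o.smallI)
    fix \<eta> :: real assume \<eta>: "\<eta> > 0"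
    from bound(2)[OF this]
    show "\<forall>\<^sub>F n in at_top. norm (\<epsilon> n) \<le> \<eta> * norm (real n)"
    proof eventually_elim
      case (elim n)
      have "log 2 (real (f_max p q r n)) \<le> e n + \<eta> * real n"
      proof (cases "f_max p q r n = 0")
        case True
        \<comment> \<open>By convention \<open>log 2 0 = 0\<close>, so here the claim rests on
          \<open>C \<ge> 0\<close>.\<close>
        then show ?thesis using e0[of n] \<eta> by (simp add: log_def)
      next
        case False
        then have "log 2 (real (f_max p q r n)) \<le> log 2 (2 powr (e n + \<eta> * real n))"
          using elim unfolding e_def by (intro log_mono) auto
        then show ?thesis by simp
      qed
      then show ?case using \<eta> unfolding \<epsilon>_def by simp
    qed
  qed
  moreover have "real (f_max p q r n) \<le> 2 powr (e n + \<epsilon> n)" for n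
  proof (cases "f_max p q r n = 0")
    case False
    then have "real (f_max p q r n) = 2 powr log 2 (real (f_max p q r n))" by simp
    also have "\<dots> \<le> 2 powr (e n + \<epsilon> n)" unfolding \<epsilon>_def by simp
    finally show ?thesis .
  qed simp
  ultimately show ?thesis unfolding e_def by (intro exI[of _ \<epsilon>]) simp
qed

end
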